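(* Let $m,n,K\ge 1$ be integers, let $\mathbf V\in\mathbb R^{m\times m}$ be the discrete Gaussian convolution matrix with parameter $\sigma>0$, let $\mathbf F_n^{(K)}\in\mathbb R^{m\times m}$ be the operator of the $n$-th order recursive filter with $K$ iterations, and let $\mathbf\Psi=\mathbf H^T\mathbf R^{-1}\mathbf H\in\mathbb R^{m\times m}$ (all as defined in the context). Let $\rho_k,\widetilde\rho_k\in\mathbb R^m$ and set $$\mathbf q_k=(I+\mathbf V\mathbf\Psi\mathbf V)\,\rho_k,\qquad \widetilde{\mathbf q}_k=(I+\mathbf F_n^{(K)}\mathbf\Psi\,\mathbf F_n^{(K)})\,\widetilde\rho_k,\qquad e_k=\rho_k-\widetilde\rho_k .$$ Then, with $\|\cdot\|=\|\cdot\|_\infty$, $$\|\mathbf q_k-\widetilde{\mathbf q}_k\|\le\bigl(1+\|\mathbf V\|\cdot\|\mathbf\Psi\|\cdot\|\mathbf V\|\bigr)\cdot\|e_k\|+\|\mathbf F_n^{(K)}-\mathbf V\|\cdot\|\mathbf\Psi\|\cdot\bigl(\|\mathbf V\|+\|\mathbf F_n^{(K)}\|\bigr)\cdot\|\widetilde\rho_k\| .$$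
   Context: Norms: $\|\cdot\|_\infty$ is the maximum norm on vectors in $\mathbb R^m$ and the induced operator norm (maximum absolute row sum) on matrices. Gaussian operator: $\mathbf V$ is the $m\times m$ matrix with entries $\mathbf V_{i,j}=\frac{1}{\sigma\sqrt{2\pi}}\exp\left(-\frac{(i-j)^2}{2\sigma^2}\right)$, $1\le i,j\le m$. Recursive filter: let $\alpha_{i,j}$ ($1\le i\le m$, $1\le j\le n$) and $\beta_i$ be real smoothing coefficients with $\beta_i=1-\sum_{j=1}^n\alpha_{i,j}$ and $\beta_i\neq 0$. The $n$-th order recursive filter with $K$ iterations maps $s^0\in\mathbb R^m$ to $s^K\in\mathbb R^m$ by performing, for $k=1,\dots,K$, $$p_i^k=\beta_i s_i^{k-1}+\sum_{j=1}^n\alpha_{i,j}p_{i-j}^k\quad(i=1,\dots,m),\qquad s_i^k=\beta_i p_i^k+\sum_{j=1}^n\alpha_{i,j}s_{i+j}^k\quad(i=m,\dots,1),$$ where terms with index $i-j<1$ or $i+j>m$ are omitted. Equivalently, $s^K=\mathbf F_n^{(K)}s^0$ with $\mathbf F_n^{(K)}=(LU)^{-K}$, where $L$ and $U$ are the lower and upper banded triangular $m\times m$ matrices whose only nonzero entries are $L_{i,i}=U_{i,i}=1/\beta_i$, $L_{i,i-j}=U_{i,i+j}=-\alpha_{i,j}/\beta_i$ for $1\le j\le n$ (when the indices lie in $\{1,\dots,m\}$). Matrix $\mathbf\Psi$: $\mathbf\Psi=\mathbf H^T\mathbf R^{-1}\mathbf H$, where $\mathbf H$ is a real matrix with $m$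 columns (the linearized observation operator) and $\mathbf R$ is an invertible diagonal covariance matrix (of the observation errors). The vectors $\rho_k$ and $\widetilde\rho_k$ are the vectors to which the iteration matrix is applied at step $k$ of the conjugate gradient method, using respectively the exact Gaussian convolution $\mathbf V$ and its replacement $\mathbf F_n^{(K)}$. *)

theory Defs
  imports "HOL-Probability.Probability_Measure" "Jordan_Normal_Form.Determinant"
begin

(* HOL-Analysis (through HOL-Probability) clashes with Jordan_Normal_Form on these names. *)
hide_type (open) Finite_Cartesian_Product.vec
hide_const (open) Finite_Cartesian_Product.mat Finite_Cartesian_Product.vec
no_notation Finite_Cartesian_Product.vec_nth (infixl \<open>$\<close> 90)

text \<open>Matrices and vectors are indexed from 0 in Jordan_Normal_Form.  The coefficients and
  the sequences of the recursive filter keep the indices \<open>1..m\<close> and \<open>1..n\<close>, so that row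
  \<open>r\<close> of a matrix belongs to the index \<open>r + 1\<close>.\<close>


section \<open>Norms and inverses\<close>

text \<open>The 0 inserted into the maximum only matters for the empty vector.\<close>

definition vec_norm_inf :: "real vec \<Rightarrow> real" where
  "vec_norm_inf v = Max (insert 0 {\<bar>v $ i\<bar> | i. i < dim_vec v})"

definition mat_norm_inf :: "real mat \<Rightarrow> real" where
  "mat_norm_inf A =
    Sup {vec_norm_inf (A *\<^sub>v x) | x. x \<in> carrier_vec (dim_col A) \<and> vec_norm_inf x \<le> 1}"

definition mat_inv :: "real mat \<Rightarrow> real mat" where
  "mat_inv A = the (mat_inverse A)"


section \<open>The Gaussian operator\<close>

definition gauss_mat :: "nat \<Rightarrow> real \<Rightarrow> real mat" where
  "gauss_mat m \<sigma> = mat m m (\<lambda>(i, j).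
     1 / (\<sigma> * sqrt (2 * pi)) * exp (- ((real i - real j)\<^sup>2 / (2 * \<sigma>\<^sup>2))))"


section \<open>The recursive filter\<close>

definition filter_beta :: "nat \<Rightarrow> (nat \<Rightarrow> nat \<Rightarrow> real) \<Rightarrow> nat \<Rightarrow> real" where
  "filter_beta n \<alpha> i = 1 - (\<Sum>j = 1..n. \<alpha> i j)"

text \<open>One iteration: \<open>p\<close> results from \<open>s\<close> by the forward sweep and \<open>s'\<close> from \<open>p\<close> by the
  backward sweep.\<close>

definition filter_iteration ::
  "nat \<Rightarrow> nat \<Rightarrow> (nat \<Rightarrow> nat \<Rightarrow> real) \<Rightarrow> (nat \<Rightarrow> real) \<Rightarrow> (nat \<Rightarrow> real) \<Rightarrow> (nat \<Rightarrow> real) \<Rightarrow> bool" where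
  "filter_iteration m n \<alpha> s p s' \<longleftrightarrow>
     (\<forall>i\<in>{1..m}. p i = filter_beta n \<alpha> i * s i
        + (\<Sum>j | j \<in> {1..n} \<and> 1 \<le> int i - int j. \<alpha> i j * p (i - j))) \<and>
     (\<forall>i\<in>{1..m}. s' i = filter_beta n \<alpha> i * p i
        + (\<Sum>j | j \<in> {1..n} \<and> i + j \<le> m. \<alpha> i j * s' (i + j)))"

definition filter_L :: "nat \<Rightarrow> nat \<Rightarrow> (nat \<Rightarrow> nat \<Rightarrow> real) \<Rightarrow> real mat" where
  "filter_L m n \<alpha> = mat m m (\<lambda>(r, c).
     if r = c then 1 / filter_beta n \<alpha> (r + 1)
     else if c < r \<and> r - c \<le> n then - \<alpha> (r + 1) (r - c) / filter_beta n \<alpha> (r + 1)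
     else 0)"

definition filter_U :: "nat \<Rightarrow> nat \<Rightarrow> (nat \<Rightarrow> nat \<Rightarrow> real) \<Rightarrow> real mat" where
  "filter_U m n \<alpha> = mat m m (\<lambda>(r, c).
     if r = c then 1 / filter_beta n \<alpha> (r + 1)
     else if r < c \<and> c - r \<le> n then - \<alpha> (r + 1) (c - r) / filter_beta n \<alpha> (r + 1)
     else 0)"

text \<open>The operator \<open>(L U)\<^sup>-\<^sup>K\<close>; \<open>filter_mat_correct\<close> below identifies it with \<open>K\<close> iterations of
  the two sweeps.\<close>

definition filter_mat :: "nat \<Rightarrow> nat \<Rightarrow> (nat \<Rightarrow> nat \<Rightarrow> real) \<Rightarrow> nat \<Rightarrow> real mat" where
  "filter_mat m n \<alpha> K = mat_inv (filter_L m n \<alpha> * filter_U m n \<alpha>) ^\<^sub>m K"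


section \<open>Covariance matrices\<close>

definition covariance_mat :: "'w measure \<Rightarrow> nat \<Rightarrow> (nat \<Rightarrow> 'w \<Rightarrow> real) \<Rightarrow> real mat" where
  "covariance_mat M d X = mat d d (\<lambda>(i, j).
     (\<integral>w. (X i w - (\<integral>v. X i v \<partial>M)) * (X j w - (\<integral>v. X j v \<partial>M)) \<partial>M))"

text \<open>\<open>R\<close> is the covariance matrix of some \<open>d\<close>-tuple of square-integrable real random
  variables on the probability space \<open>M\<close>.\<close>

definition is_covariance_mat :: "'w measure \<Rightarrow> nat \<Rightarrow> (nat \<Rightarrow> 'w \<Rightarrow> real) \<Rightarrow> real mat \<Rightarrow> bool" where
  "is_covariance_mat M d X R \<longleftrightarrow>
     prob_space M \<and>
     (\<forall>i<d. X i \<in> borel_measurable M \<and> integrable M (\<lambda>w. (X i w)\<^sup>2)) \<and>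
     R = covariance_mat M d X"


section \<open>Adequacy of the definitions\<close>

lemma vec_norm_inf_nonneg: "0 \<le> vec_norm_inf v"
  unfolding vec_norm_inf_def by (rule Max_ge) auto

lemma vec_norm_inf_ge: "i < dim_vec v \<Longrightarrow> \<bar>v $ i\<bar> \<le> vec_norm_inf v"
  unfolding vec_norm_inf_def by (rule Max_ge) auto

lemma vec_norm_inf_le:
  "0 \<le> b \<Longrightarrow> (\<And>i. i < dim_vec v \<Longrightarrow> \<bar>v $ i\<bar> \<le> b) \<Longrightarrow> vec_norm_inf v \<le> b"
  unfolding vec_norm_inf_def by (subst Max_le_iff) auto

text \<open>The induced norm is the maximum absolute row sum.\<close>

lemma mat_norm_inf_row_sum:
  assumes "0 < dim_row A"
  shows "mat_norm_inf A = Max {(\<Sum>j<dim_col A. \<bar>A $$ (i, j)\<bar>) | i. i < dim_row A}"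
proof -
  let ?r = "\<lambda>i. \<Sum>j<dim_col A. \<bar>A $$ (i, j)\<bar>"
  let ?S = "{vec_norm_inf (A *\<^sub>v x) | x. x \<in> carrier_vec (dim_col A) \<and> vec_norm_inf x \<le> 1}"
  have fin: "finite {?r i | i. i < dim_row A}" by simp
  have entry: "(A *\<^sub>v x) $ i = (\<Sum>j<dim_col A. A $$ (i, j) * x $ j)"
    if "i < dim_row A" "x \<in> carrier_vec (dim_col A)" for i x
    using that by (auto simp: scalar_prod_def lessThan_atLeast0 intro!: sum.cong)
  obtain i0 where i0: "i0 < dim_row A" "Max {?r i | i. i < dim_row A} = ?r i0"
    using Max_in[OF fin] assms by blast
  have le: "?r i \<le> ?r i0" if "i < dim_row A" for i
    unfolding i0(2)[symmetric] using that by (intro Max_ge[OF fin]) auto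
  define x where "x = vec (dim_col A) (\<lambda>j. sgn (A $$ (i0, j)))"
  have x: "x \<in> carrier_vec (dim_col A)" "vec_norm_inf x \<le> 1"
    by (auto simp: x_def abs_sgn_eq intro!: vec_norm_inf_le)
  have "(A *\<^sub>v x) $ i0 = ?r i0"
    unfolding entry[OF i0(1) x(1)] by (rule sum.cong) (auto simp: x_def abs_sgn)
  then have "?r i0 \<le> vec_norm_inf (A *\<^sub>v x)"
    using vec_norm_inf_ge[of i0 "A *\<^sub>v x"] i0(1) by auto
  moreover have ub: "vec_norm_inf (A *\<^sub>v y) \<le> ?r i0"
    if y: "y \<in> carrier_vec (dim_col A)" "vec_norm_inf y \<le> 1" for y
  proof (rule vec_norm_inf_le)
    show "0 \<le> ?r i0" by (rule sum_nonneg) simp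
    fix i assume "i < dim_vec (A *\<^sub>v y)"
    then have i: "i < dim_row A" by simp
    have "\<bar>y $ j\<bar> \<le> 1" if "j < dim_col A" for j
      using vec_norm_inf_ge[of j y] y that by auto
    then have "\<bar>A $$ (i, j) * y $ j\<bar> \<le> \<bar>A $$ (i, j)\<bar>" if "j < dim_col A" for j
      using that by (auto simp: abs_mult intro: mult_left_le)
    then have "\<bar>(A *\<^sub>v y) $ i\<bar> \<le> ?r i"
      unfolding entry[OF i y(1)] by (intro order.trans[OF sum_abs] sum_mono) auto
    with le[OF i] show "\<bar>(A *\<^sub>v y) $ i\<bar> \<le> ?r i0" by simp
  qed
  ultimately have "Sup ?S = ?r i0"
    using x by (intro cSup_eq_maximum) (auto intro: antisym)
  then show ?thesis by (simp add: mat_norm_inf_def i0(2))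
qed

lemma mat_inv:
  assumes A: "A \<in> carrier_mat d d" and inv: "invertible_mat A"
  shows "mat_inv A \<in> carrier_mat d d" "A * mat_inv A = 1\<^sub>m d" "mat_inv A * A = 1\<^sub>m d"
proof -
  from inv obtain B where "inverts_mat A B" "inverts_mat B A"
    by (auto simp: invertible_mat_def)
  then have AB: "A * B = 1\<^sub>m d" and BA: "B * A = 1\<^sub>m (dim_row B)"
    using A by (auto simp: inverts_mat_def)
  have "dim_col B = d" using arg_cong[OF AB, of dim_col] by simp
  moreover have "dim_row B = d" using arg_cong[OF BA, of dim_col] A by simp
  ultimately have "B \<in> carrier_mat d d" "B * A = 1\<^sub>m d" using BA by auto
  with A AB have "A \<in> Units (ring_mat TYPE(real) d ())"
    by (auto simp: Units_def ring_mat_def)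
  with mat_inverse(1)[OF A, of "()"] obtain C where C: "mat_inverse A = Some C" by auto
  from mat_inverse(2)[OF A C] C
  show "mat_inv A \<in> carrier_mat d d" "A * mat_inv A = 1\<^sub>m d" "mat_inv A * A = 1\<^sub>m d"
    by (auto simp: mat_inv_def)
qed

lemma filter_carrier:
  "filter_L m n \<alpha> \<in> carrier_mat m m" "filter_U m n \<alpha> \<in> carrier_mat m m"
  by (auto simp: filter_L_def filter_U_def)

lemma filter_LU_invertible:
  assumes "\<forall>i\<in>{1..m}. filter_beta n \<alpha> i \<noteq> 0"
  shows "invertible_mat (filter_L m n \<alpha> * filter_U m n \<alpha>)"
proof -
  let ?L = "filter_L m n \<alpha>" and ?U = "filter_U m n \<alpha>"
  have nz: "filter_beta n \<alpha> (Suc r) \<noteq> 0" if "r < m" for r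
    using assms that by auto
  have "det ?L = prod_list (diag_mat ?L)"
    by (rule det_lower_triangular[OF _ filter_carrier(1)]) (auto simp: filter_L_def)
  moreover have "0 \<notin> set (diag_mat ?L)"
    using nz by (auto simp: diag_mat_def filter_L_def)
  moreover have "det ?U = prod_list (diag_mat ?U)"
    by (rule det_upper_triangular[OF _ filter_carrier(2)])
      (auto simp: filter_U_def upper_triangular_def)
  moreover have "0 \<notin> set (diag_mat ?U)"
    using nz by (auto simp: diag_mat_def filter_U_def)
  ultimately have "det (?L * ?U) \<noteq> 0"
    unfolding det_mult[OF filter_carrier] by (simp add: prod_list_zero_iff)
  from det_non_zero_imp_unit[OF _ this, of m "()"] filter_carrier[of m n \<alpha>]
  obtain B where B: "B \<in> carrier_mat m m" "?L * ?U * B = 1\<^sub>m m" "B * (?L * ?U) = 1\<^sub>m m"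
    by (auto simp: Units_def ring_mat_def)
  have LU: "?L * ?U \<in> carrier_mat m m"
    by (rule mult_carrier_mat[OF filter_carrier])
  have "inverts_mat (?L * ?U) B" "inverts_mat B (?L * ?U)"
    unfolding inverts_mat_def carrier_matD(1)[OF LU] carrier_matD(1)[OF B(1)]
    by (fact B)+
  moreover have "square_mat (?L * ?U)"
    unfolding square_mat.simps carrier_matD[OF LU] ..
  ultimately show ?thesis unfolding invertible_mat_def by blast
qed

lemma filter_L_mult:
  assumes "r < m"
  shows "(filter_L m n \<alpha> *\<^sub>v vec m (\<lambda>r. p (r + 1))) $ r = (p (r + 1)
     - (\<Sum>j | j \<in> {1..n} \<and> 1 \<le> int (r + 1) - int j. \<alpha> (r + 1) j * p (r + 1 - j)))
     / filter_beta n \<alpha> (r + 1)"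
proof -
  let ?b = "filter_beta n \<alpha> (r + 1)"
  let ?J = "{j. j \<in> {1..n} \<and> 1 \<le> int (r + 1) - int j}"
  let ?C = "{c. c < r \<and> r - c \<le> n}"
  have "(filter_L m n \<alpha> *\<^sub>v vec m (\<lambda>r. p (r + 1))) $ r
      = (\<Sum>c<m. (if c = r then p (r + 1) / ?b else 0)
          - (if c \<in> ?C then \<alpha> (r + 1) (r - c) * p (c + 1) / ?b else 0))"
    using assms by (auto simp: filter_L_def scalar_prod_def lessThan_atLeast0 intro!: sum.cong)
  also have "\<dots> = p (r + 1) / ?b - (\<Sum>c\<in>?C. \<alpha> (r + 1) (r - c) * p (c + 1) / ?b)"
    using assms by (auto simp: sum_subtractf sum.If_cases intro!: sum.cong)
  also have "(\<Sum>c\<in>?C. \<alpha> (r + 1) (r - c) * p (c + 1) / ?b)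
      = (\<Sum>j\<in>?J. \<alpha> (r + 1) j * p (r + 1 - j) / ?b)"
    by (rule sum.reindex_bij_witness[of _ "\<lambda>j. r - j" "\<lambda>c. r - c"]) (auto simp: Suc_diff_le)
  finally show ?thesis
    by (simp add: diff_divide_distrib sum_divide_distrib)
qed

lemma filter_U_mult:
  assumes "r < m"
  shows "(filter_U m n \<alpha> *\<^sub>v vec m (\<lambda>r. p (r + 1))) $ r = (p (r + 1)
     - (\<Sum>j | j \<in> {1..n} \<and> r + 1 + j \<le> m. \<alpha> (r + 1) j * p (r + 1 + j)))
     / filter_beta n \<alpha> (r + 1)"
proof -
  let ?b = "filter_beta n \<alpha> (r + 1)"
  let ?J = "{j. j \<in> {1..n} \<and> r + 1 + j \<le> m}"
  let ?C = "{c. c < m \<and> r < c \<and> c - r \<le> n}"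
  have "(filter_U m n \<alpha> *\<^sub>v vec m (\<lambda>r. p (r + 1))) $ r
      = (\<Sum>c<m. (if c = r then p (r + 1) / ?b else 0)
          - (if c \<in> ?C then \<alpha> (r + 1) (c - r) * p (c + 1) / ?b else 0))"
    using assms by (auto simp: filter_U_def scalar_prod_def lessThan_atLeast0 intro!: sum.cong)
  also have "\<dots> = p (r + 1) / ?b - (\<Sum>c\<in>?C. \<alpha> (r + 1) (c - r) * p (c + 1) / ?b)"
    using assms by (auto simp: sum_subtractf sum.If_cases intro!: sum.cong)
  also have "(\<Sum>c\<in>?C. \<alpha> (r + 1) (c - r) * p (c + 1) / ?b)
      = (\<Sum>j\<in>?J. \<alpha> (r + 1) j * p (r + 1 + j) / ?b)"
    by (rule sum.reindex_bij_witness[of _ "\<lambda>j. r + j" "\<lambda>c. c - r"]) auto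
  finally show ?thesis
    by (simp add: diff_divide_distrib sum_divide_distrib)
qed

lemma filter_iteration_iff:
  assumes nz: "\<forall>i\<in>{1..m}. filter_beta n \<alpha> i \<noteq> 0"
  shows "filter_iteration m n \<alpha> s p s' \<longleftrightarrow>
     filter_L m n \<alpha> *\<^sub>v vec m (\<lambda>r. p (r + 1)) = vec m (\<lambda>r. s (r + 1)) \<and>
     filter_U m n \<alpha> *\<^sub>v vec m (\<lambda>r. s' (r + 1)) = vec m (\<lambda>r. p (r + 1))"
proof -
  have idx: "(\<forall>i\<in>{1..m}. P i) \<longleftrightarrow> (\<forall>r<m. P (r + 1))" for P
  proof safe
    fix i assume "\<forall>r<m. P (r + 1)" "i \<in> {1..m}"
    then show "P i" by (cases i) auto
  qed auto
  have eq: "v = vec m f \<longleftrightarrow> (\<forall>r<m. v $ r = f r)" if "dim_vec v = m" for v :: "real vec" and f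
  proof
    assume "v = vec m f"
    then show "\<forall>r<m. v $ r = f r" by simp
  next
    assume "\<forall>r<m. v $ r = f r"
    with that show "v = vec m f" by (intro eq_vecI) simp_all
  qed
  have solve: "x = b * y + t \<longleftrightarrow> (x - t) / b = y" if "b \<noteq> 0" for x b y t :: real
    using that by (auto simp: field_simps)
  have nz': "filter_beta n \<alpha> (r + 1) \<noteq> 0" if "r < m" for r
    using nz that by auto
  have dim: "dim_vec (filter_L m n \<alpha> *\<^sub>v v) = m" "dim_vec (filter_U m n \<alpha> *\<^sub>v v) = m" for v
    by (simp_all add: filter_L_def filter_U_def)
  show ?thesis
    unfolding filter_iteration_def idx eq[OF dim(1)] eq[OF dim(2)]
    by (intro arg_cong2[of _ _ _ _ "(\<and>)"] all_cong1 imp_cong refl)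
      (simp_all only: filter_L_mult filter_U_mult solve[OF nz'])
qed

lemma filter_iteration_unique:
  assumes nz: "\<forall>i\<in>{1..m}. filter_beta n \<alpha> i \<noteq> 0"
  shows "(\<exists>p. filter_iteration m n \<alpha> s p s') \<longleftrightarrow>
     vec m (\<lambda>r. s' (r + 1)) =
     mat_inv (filter_L m n \<alpha> * filter_U m n \<alpha>) *\<^sub>v vec m (\<lambda>r. s (r + 1))"
    (is "_ \<longleftrightarrow> ?v s' = ?G *\<^sub>v ?v s")
proof -
  let ?L = "filter_L m n \<alpha>" and ?U = "filter_U m n \<alpha>"
  note LU = filter_carrier[of m n \<alpha>]
  have LUc: "?L * ?U \<in> carrier_mat m m" using LU by auto
  note G = mat_inv[OF LUc filter_LU_invertible[OF nz]]
  have v: "?v f \<in> carrier_vec m" for f by simp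
  have Uv: "?U *\<^sub>v ?v s' \<in> carrier_vec m" using LU(2) by auto
  define p where "p i = (?U *\<^sub>v ?v s') $ (i - 1)" for i
  have p: "?v p = ?U *\<^sub>v ?v s'"
  proof (rule eq_vecI)
    fix i assume "i < dim_vec (?U *\<^sub>v ?v s')"
    then have "i < m" unfolding carrier_vecD[OF Uv] .
    then show "?v p $ i = (?U *\<^sub>v ?v s') $ i"
      by (simp only: index_vec p_def add_diff_cancel_right')
  qed (simp only: carrier_vecD[OF Uv] dim_vec)
  have "(\<exists>p. filter_iteration m n \<alpha> s p s') \<longleftrightarrow> ?L *\<^sub>v (?U *\<^sub>v ?v s') = ?v s"
    (is "_ \<longleftrightarrow> ?R")
  proof
    assume "\<exists>p. filter_iteration m n \<alpha> s p s'"
    then obtain p' where "filter_iteration m n \<alpha> s p' s'" by blast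
    then have "?L *\<^sub>v ?v p' = ?v s" "?U *\<^sub>v ?v s' = ?v p'"
      by (simp_all only: filter_iteration_iff[OF nz])
    then show ?R by (simp only:)
  next
    assume ?R
    then have "filter_iteration m n \<alpha> s p s'"
      unfolding filter_iteration_iff[OF nz] p by blast
    then show "\<exists>p. filter_iteration m n \<alpha> s p s'" by blast
  qed
  also have "\<dots> \<longleftrightarrow> ?L * ?U *\<^sub>v ?v s' = ?v s"
    by (simp only: assoc_mult_mat_vec[OF LU v])
  also have "\<dots> \<longleftrightarrow> ?v s' = ?G *\<^sub>v ?v s"
  proof
    assume "?L * ?U *\<^sub>v ?v s' = ?v s"
    then have "?G *\<^sub>v ?v s = ?G * (?L * ?U) *\<^sub>v ?v s'"
      by (simp only: assoc_mult_mat_vec[OF G(1) LUc v])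
    then show "?v s' = ?G *\<^sub>v ?v s"
      unfolding G(3) one_mult_mat_vec[OF v] by (rule sym)
  next
    assume "?v s' = ?G *\<^sub>v ?v s"
    then have "?L * ?U *\<^sub>v ?v s' = ?L * ?U * ?G *\<^sub>v ?v s"
      by (simp only: assoc_mult_mat_vec[OF LUc G(1) v])
    then show "?L * ?U *\<^sub>v ?v s' = ?v s"
      unfolding G(2) one_mult_mat_vec[OF v] .
  qed
  finally show ?thesis .
qed

text \<open>\<open>K\<close> iterations of the recursive filter are the application of \<open>filter_mat m n \<alpha> K\<close>.\<close>

lemma filter_mat_correct:
  assumes nz: "\<forall>i\<in>{1..m}. filter_beta n \<alpha> i \<noteq> 0"
    and it: "\<And>k. k \<in> {1..K} \<Longrightarrow> filter_iteration m n \<alpha> (s (k - 1)) (p k) (s k)"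
  shows "vec m (\<lambda>r. s K (r + 1)) = filter_mat m n \<alpha> K *\<^sub>v vec m (\<lambda>r. s 0 (r + 1))"
proof -
  let ?G = "mat_inv (filter_L m n \<alpha> * filter_U m n \<alpha>)"
  have LUc: "filter_L m n \<alpha> * filter_U m n \<alpha> \<in> carrier_mat m m"
    using filter_carrier[of m n \<alpha>] by auto
  note G = mat_inv(1)[OF LUc filter_LU_invertible[OF nz]]
  have comm: "?G ^\<^sub>m Suc k = ?G * ?G ^\<^sub>m k" for k
  proof (induction k)
    case 0
    show ?case using G by simp
  next
    case (Suc k)
    have "?G ^\<^sub>m Suc (Suc k) = ?G * ?G ^\<^sub>m k * ?G"
      unfolding pow_mat.simps(2)[of _ "Suc k"] Suc ..
    also have "\<dots> = ?G * (?G ^\<^sub>m k * ?G)"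
      by (rule assoc_mult_mat[OF G _ G]) (use G in auto)
    finally show ?case by (simp only: pow_mat.simps(2))
  qed
  have "vec m (\<lambda>r. s k (r + 1)) = ?G ^\<^sub>m k *\<^sub>v vec m (\<lambda>r. s 0 (r + 1))" if "k \<le> K" for k
    using that
  proof (induction k)
    case 0
    then show ?case using G by simp
  next
    case (Suc k)
    have "filter_iteration m n \<alpha> (s k) (p (Suc k)) (s (Suc k))"
      using it[of "Suc k"] Suc.prems by simp
    then have "vec m (\<lambda>r. s (Suc k) (r + 1)) = ?G *\<^sub>v vec m (\<lambda>r. s k (r + 1))"
      using filter_iteration_unique[OF nz] by blast
    also have "\<dots> = ?G *\<^sub>v (?G ^\<^sub>m k *\<^sub>v vec m (\<lambda>r. s 0 (r + 1)))"
      using Suc by simp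
    also have "\<dots> = ?G ^\<^sub>m Suc k *\<^sub>v vec m (\<lambda>r. s 0 (r + 1))"
      unfolding comm by (rule assoc_mult_mat_vec[symmetric, OF G]) (use G in auto)
    finally show ?case .
  qed
  from this[OF order_refl] show ?thesis
    unfolding filter_mat_def .
qed

end

theory Submission
  imports Defs
begin

text \<open>
  The estimate is a perturbation bound. Replacing the operator \<open>V\<close> by \<open>F\<close> and the vector
  \<open>\<rho>\<close> by \<open>\<rho>'\<close> one factor at a time splits the error into contributions that each contain
  exactly one small factor, namely \<open>e\<close> or \<open>F - V\<close>:
  \<open>q - q' = (e + V \<Psi> V e) - ((F - V) \<Psi> V \<rho>' + F \<Psi> (F - V) \<rho>')\<close>.
  The maximum norm satisfies the triangle inequality and is compatible with the induced
  norm (\<open>vec_norm_inf_mult_mat_vec\<close>), so each term is bounded by the product of the norms of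
  its factors. The identity is \<open>two_sided_product_perturbation\<close>, an algebraic fact about square
  matrices of equal size.
\<close>

lemma vec_norm_inf_add:
  assumes "u \<in> carrier_vec d" and "v \<in> carrier_vec d"
  shows "vec_norm_inf (u + v) \<le> vec_norm_inf u + vec_norm_inf v"
proof (rule vec_norm_inf_le)
  show "0 \<le> vec_norm_inf u + vec_norm_inf v"
    by (simp add: vec_norm_inf_nonneg)
  fix i assume "i < dim_vec (u + v)"
  then show "\<bar>(u + v) $ i\<bar> \<le> vec_norm_inf u + vec_norm_inf v"
    using vec_norm_inf_ge[of i u] vec_norm_inf_ge[of i v] assms by auto
qed

lemma vec_norm_inf_diff:
  assumes "u \<in> carrier_vec d" and "v \<in> carrier_vec d"
  shows "vec_norm_inf (u - v) \<le> vec_norm_inf u + vec_norm_inf v"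
proof (rule vec_norm_inf_le)
  show "0 \<le> vec_norm_inf u + vec_norm_inf v"
    by (simp add: vec_norm_inf_nonneg)
  fix i assume "i < dim_vec (u - v)"
  then show "\<bar>(u - v) $ i\<bar> \<le> vec_norm_inf u + vec_norm_inf v"
    using vec_norm_inf_ge[of i u] vec_norm_inf_ge[of i v] assms by auto
qed

text \<open>A row sum is one of the candidates in the maximum that computes the induced norm.\<close>

lemma row_sum_le_mat_norm_inf:
  assumes "i < dim_row A"
  shows "(\<Sum>j<dim_col A. \<bar>A $$ (i, j)\<bar>) \<le> mat_norm_inf A"
proof -
  have "0 < dim_row A" using assms by simp
  then show ?thesis
    unfolding mat_norm_inf_row_sum[OF \<open>0 < dim_row A\<close>] using assms by (intro Max_ge) auto
qed

text \<open>The row-sum formula presupposes a row. A matrix without rows sends every vector to the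
  empty vector, so its norm is the supremum of \<open>{0}\<close>.\<close>

lemma mat_norm_inf_nonneg: "0 \<le> mat_norm_inf A"
proof (cases "dim_row A = 0")
  case True
  then have norm0: "vec_norm_inf (A *\<^sub>v x) = 0" for x
    by (simp add: vec_norm_inf_def)
  have "\<exists>x. x \<in> carrier_vec (dim_col A) \<and> vec_norm_inf x \<le> 1"
    by (rule exI[of _ "0\<^sub>v (dim_col A)"]) (auto intro: vec_norm_inf_le)
  then show ?thesis
    by (simp add: mat_norm_inf_def norm0)
next
  case False
  then have "0 < dim_row A" by simp
  have "0 \<le> (\<Sum>j<dim_col A. \<bar>A $$ (0, j)\<bar>)" by (rule sum_nonneg) simp
  also have "\<dots> \<le> mat_norm_inf A" by (rule row_sum_le_mat_norm_inf) fact
  finally show ?thesis .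
qed

text \<open>Bounding every entry of \<open>x\<close> by its norm leaves a row sum of \<open>A\<close> as the factor.\<close>

lemma vec_norm_inf_mult_mat_vec:
  assumes "A \<in> carrier_mat d k" and "x \<in> carrier_vec k"
  shows "vec_norm_inf (A *\<^sub>v x) \<le> mat_norm_inf A * vec_norm_inf x"
proof (rule vec_norm_inf_le)
  show "0 \<le> mat_norm_inf A * vec_norm_inf x"
    by (simp add: mat_norm_inf_nonneg vec_norm_inf_nonneg)
  fix i assume "i < dim_vec (A *\<^sub>v x)"
  then have i: "i < dim_row A" by simp
  have "(A *\<^sub>v x) $ i = (\<Sum>j<dim_col A. A $$ (i, j) * x $ j)"
    using i assms by (auto simp: scalar_prod_def lessThan_atLeast0 intro!: sum.cong)
  also have "\<bar>\<dots>\<bar> \<le> (\<Sum>j<dim_col A. \<bar>A $$ (i, j)\<bar> * vec_norm_inf x)"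
    using assms
    by (intro order.trans[OF sum_abs] sum_mono)
      (auto simp: abs_mult intro!: mult_left_mono vec_norm_inf_ge)
  also have "\<dots> = (\<Sum>j<dim_col A. \<bar>A $$ (i, j)\<bar>) * vec_norm_inf x"
    by (simp add: sum_distrib_right)
  also have "\<dots> \<le> mat_norm_inf A * vec_norm_inf x"
    by (intro mult_right_mono row_sum_le_mat_norm_inf i vec_norm_inf_nonneg)
  finally show "\<bar>(A *\<^sub>v x) $ i\<bar> \<le> mat_norm_inf A * vec_norm_inf x" .
qed

text \<open>Submultiplicativity in the form in which a threefold product acts on a vector.\<close>

lemma vec_norm_inf_mult_mat_vec3:
  assumes A: "A \<in> carrier_mat d d" and B: "B \<in> carrier_mat d d" and C: "C \<in> carrier_mat d d"
    and x: "x \<in> carrier_vec d"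
  shows "vec_norm_inf (A *\<^sub>v (B *\<^sub>v (C *\<^sub>v x)))
    \<le> mat_norm_inf A * mat_norm_inf B * mat_norm_inf C * vec_norm_inf x"
proof -
  have Cx: "C *\<^sub>v x \<in> carrier_vec d" and BCx: "B *\<^sub>v (C *\<^sub>v x) \<in> carrier_vec d"
    using B C x by auto
  have "vec_norm_inf (A *\<^sub>v (B *\<^sub>v (C *\<^sub>v x))) \<le> mat_norm_inf A * vec_norm_inf (B *\<^sub>v (C *\<^sub>v x))"
    by (rule vec_norm_inf_mult_mat_vec[OF A BCx])
  also have "\<dots> \<le> mat_norm_inf A * (mat_norm_inf B * vec_norm_inf (C *\<^sub>v x))"
    by (intro mult_left_mono vec_norm_inf_mult_mat_vec[OF B Cx] mat_norm_inf_nonneg)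
  also have "\<dots> \<le> mat_norm_inf A * (mat_norm_inf B * (mat_norm_inf C * vec_norm_inf x))"
    by (intro mult_left_mono vec_norm_inf_mult_mat_vec[OF C x] mat_norm_inf_nonneg)
  finally show ?thesis by (simp add: mult.assoc)
qed

text \<open>Inserting \<open>V \<Psi> V \<rho>'\<close> separates the change of the vector from that of the operator, and
  inserting \<open>F \<Psi> V \<rho>'\<close> separates the change of the left factor from that of the right one.\<close>

lemma two_sided_product_perturbation:
  fixes V F \<Psi> :: "real mat"
  assumes V: "V \<in> carrier_mat m m" and F: "F \<in> carrier_mat m m" and P: "\<Psi> \<in> carrier_mat m m"
    and r: "\<rho> \<in> carrier_vec m" and r': "\<rho>' \<in> carrier_vec m"
  shows "(1\<^sub>m m + V * \<Psi> * V) *\<^sub>v \<rho> - (1\<^sub>m m + F * \<Psi> * F) *\<^sub>v \<rho>' =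
    ((\<rho> - \<rho>') + V *\<^sub>v (\<Psi> *\<^sub>v (V *\<^sub>v (\<rho> - \<rho>'))))
    - ((F - V) *\<^sub>v (\<Psi> *\<^sub>v (V *\<^sub>v \<rho>')) + F *\<^sub>v (\<Psi> *\<^sub>v ((F - V) *\<^sub>v \<rho>')))"
proof -
  have expand: "(1\<^sub>m m + A * \<Psi> * A) *\<^sub>v x = x + A *\<^sub>v (\<Psi> *\<^sub>v (A *\<^sub>v x))"
    if A: "A \<in> carrier_mat m m" and x: "x \<in> carrier_vec m" for A x
  proof -
    have AP: "A * \<Psi> \<in> carrier_mat m m" and Ax: "A *\<^sub>v x \<in> carrier_vec m"
      using A P x by auto
    have "(1\<^sub>m m + A * \<Psi> * A) *\<^sub>v x = 1\<^sub>m m *\<^sub>v x + A * \<Psi> * A *\<^sub>v x"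
      by (rule add_mult_distrib_mat_vec[OF one_carrier_mat mult_carrier_mat[OF AP A] x])
    also have "1\<^sub>m m *\<^sub>v x = x" by (rule one_mult_mat_vec[OF x])
    also have "A * \<Psi> * A *\<^sub>v x = A *\<^sub>v (\<Psi> *\<^sub>v (A *\<^sub>v x))"
      unfolding assoc_mult_mat_vec[OF AP A x] by (rule assoc_mult_mat_vec[OF A P Ax])
    finally show ?thesis .
  qed
  have c: "A *\<^sub>v x \<in> carrier_vec m" if "A \<in> carrier_mat m m" "x \<in> carrier_vec m"
    for A :: "real mat" and x
    using that by simp
  note carriers = c[OF V] c[OF F] c[OF P] r r' minus_carrier_vec
  note linear = mult_minus_distrib_mat_vec[of _ m m] minus_mult_distrib_mat_vec[of _ m m]
  have vec: "V *\<^sub>v (\<Psi> *\<^sub>v (V *\<^sub>v (\<rho> - \<rho>')))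
      = V *\<^sub>v (\<Psi> *\<^sub>v (V *\<^sub>v \<rho>)) - V *\<^sub>v (\<Psi> *\<^sub>v (V *\<^sub>v \<rho>'))"
    by (simp only: linear V P carriers)
  have left: "(F - V) *\<^sub>v (\<Psi> *\<^sub>v (V *\<^sub>v \<rho>'))
      = F *\<^sub>v (\<Psi> *\<^sub>v (V *\<^sub>v \<rho>')) - V *\<^sub>v (\<Psi> *\<^sub>v (V *\<^sub>v \<rho>'))"
    by (simp only: linear V F carriers)
  have right: "F *\<^sub>v (\<Psi> *\<^sub>v ((F - V) *\<^sub>v \<rho>'))
      = F *\<^sub>v (\<Psi> *\<^sub>v (F *\<^sub>v \<rho>')) - F *\<^sub>v (\<Psi> *\<^sub>v (V *\<^sub>v \<rho>'))"
    by (simp only: linear V F P carriers)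
  have cancel: "(x + a) - (y + b) = ((x - y) + (a - g)) - ((h - g) + (b - h))"
    if "x \<in> carrier_vec m" "y \<in> carrier_vec m" "a \<in> carrier_vec m" "b \<in> carrier_vec m"
      "g \<in> carrier_vec m" "h \<in> carrier_vec m" for x y a b g h :: "real vec"
    using that by (intro eq_vecI) auto
  show ?thesis
    unfolding expand[OF V r] expand[OF F r'] vec left right
    by (intro cancel carriers)
qed

text \<open>An inverse has the expected dimensions only when it exists, and \<open>L U\<close> is invertible
  because its triangular factors have the nonzero diagonal entries \<open>1 / \<beta>\<^sub>i\<close>.\<close>

lemma filter_mat_carrier:
  assumes "\<forall>i\<in>{1..m}. filter_beta n \<alpha> i \<noteq> 0"
  shows "filter_mat m n \<alpha> K \<in> carrier_mat m m"
  unfolding filter_mat_def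
  by (intro pow_carrier_mat mat_inv(1) mult_carrier_mat[OF filter_carrier]
      filter_LU_invertible assms)

theorem theorem4p1:
  fixes m n K d :: nat
    and \<sigma> :: real
    and \<alpha> :: "nat \<Rightarrow> nat \<Rightarrow> real"
    and V F \<Psi> H R :: "real mat"
    and M :: "'w measure"
    and X :: "nat \<Rightarrow> 'w \<Rightarrow> real"
    and \<rho> \<rho>' q q' e :: "real vec"
  assumes "m \<ge> 1" and "n \<ge> 1" and "K \<ge> 1"
    and "\<sigma> > 0"
    and V: "V = gauss_mat m \<sigma>"
    and beta: "\<forall>i\<in>{1..m}. filter_beta n \<alpha> i \<noteq> 0"
    and F: "F = filter_mat m n \<alpha> K"
    and H: "H \<in> carrier_mat d m"
    and R_cov: "is_covariance_mat M d X R"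
    and R_diag: "diagonal_mat R"
    and R_inv: "invertible_mat R"
    and Psi: "\<Psi> = transpose_mat H * mat_inv R * H"
    and rho: "\<rho> \<in> carrier_vec m" and rho': "\<rho>' \<in> carrier_vec m"
    and q: "q = (1\<^sub>m m + V * \<Psi> * V) *\<^sub>v \<rho>"
    and q': "q' = (1\<^sub>m m + F * \<Psi> * F) *\<^sub>v \<rho>'"
    and e: "e = \<rho> - \<rho>'"
  shows "vec_norm_inf (q - q') \<le>
    (1 + mat_norm_inf V * mat_norm_inf \<Psi> * mat_norm_inf V) * vec_norm_inf e
    + mat_norm_inf (F - V) * mat_norm_inf \<Psi> * (mat_norm_inf V + mat_norm_inf F) * vec_norm_inf \<rho>'"
proof -
  have Vc: "V \<in> carrier_mat m m" unfolding V by (simp add: gauss_mat_def)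
  have Fc: "F \<in> carrier_mat m m" unfolding F by (rule filter_mat_carrier[OF beta])
  have "R \<in> carrier_mat d d"
    using R_cov by (auto simp: is_covariance_mat_def covariance_mat_def)
  from mat_inv(1)[OF this R_inv] H have Pc: "\<Psi> \<in> carrier_mat m m"
    unfolding Psi by auto
  have ec: "e \<in> carrier_vec m" using rho rho' unfolding e by simp
  have Dc: "F - V \<in> carrier_mat m m" using Vc by (rule minus_carrier_mat)
  let ?a = "V *\<^sub>v (\<Psi> *\<^sub>v (V *\<^sub>v e))"
  let ?b = "(F - V) *\<^sub>v (\<Psi> *\<^sub>v (V *\<^sub>v \<rho>'))"
  let ?c = "F *\<^sub>v (\<Psi> *\<^sub>v ((F - V) *\<^sub>v \<rho>'))"
  have ac: "?a \<in> carrier_vec m" and bc: "?b \<in> carrier_vec m" and cc: "?c \<in> carrier_vec m"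
    by (intro mult_mat_vec_carrier[of _ m m] Vc Fc Pc Dc ec rho')+
  have split: "q - q' = (e + ?a) - (?b + ?c)"
    unfolding q q' e by (rule two_sided_product_perturbation[OF Vc Fc Pc rho rho'])
  have "vec_norm_inf (q - q')
      \<le> (vec_norm_inf e + vec_norm_inf ?a) + (vec_norm_inf ?b + vec_norm_inf ?c)"
    unfolding split
    using vec_norm_inf_diff[OF add_carrier_vec[OF ec ac] add_carrier_vec[OF bc cc]]
      vec_norm_inf_add[OF ec ac] vec_norm_inf_add[OF bc cc] by linarith
  also have "\<dots> \<le> (vec_norm_inf e
        + mat_norm_inf V * mat_norm_inf \<Psi> * mat_norm_inf V * vec_norm_inf e)
      + (mat_norm_inf (F - V) * mat_norm_inf \<Psi> * mat_norm_inf V * vec_norm_inf \<rho>'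
        + mat_norm_inf F * mat_norm_inf \<Psi> * mat_norm_inf (F - V) * vec_norm_inf \<rho>')"
    by (intro add_mono order_refl vec_norm_inf_mult_mat_vec3[of _ m] Vc Fc Pc Dc ec rho')
  also have "\<dots> = (1 + mat_norm_inf V * mat_norm_inf \<Psi> * mat_norm_inf V) * vec_norm_inf e
    + mat_norm_inf (F - V) * mat_norm_inf \<Psi> * (mat_norm_inf V + mat_norm_inf F) * vec_norm_inf \<rho>'"
    by (simp add: algebra_simps)
  finally show ?thesis .
qed

end
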